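(* Let $P\in\mathbb{S}^{n_x}_{++}$ and $K\in\mathbb{R}^{n_u\times n_x}$, and let $G\in\mathbb{R}^{n_x\times n_d}$. Suppose there exist nonnegative scalars $\alpha_0,\alpha_1,\ldots,\alpha_{T-1}$ and a scalar $\beta>0$ such that $$\begin{bmatrix} P-GG^\top-\beta I & 0\\ 0 & -\begin{bmatrix} I\\ K\end{bmatrix}P\begin{bmatrix} I\\ K\end{bmatrix}^\top\end{bmatrix}-\sum_{i=0}^{T-1}\alpha_i\Psi_i\succeq 0 .$$ Then for all $(A,B)\in\Sigma$, $$\begin{bmatrix} P & (A+BK)P & G\\ P(A+BK)^\top & P & 0\\ G^\top & 0 & I\end{bmatrix}\succ 0 .$$
   Context: $\mathbb{S}^{n}_{++}$ denotes the set of real symmetric positive definite $n\times n$ matrices; $M\succ0$ ($M\succeq 0$) means $M$ is symmetric positive definite (positive semidefinite). Data: a positive integer $T$, states $x_0,\ldots,x_T\in\mathbb{R}^{n_x}$ and inputs $u_0,\ldots,u_{T-1}\in\mathbb{R}^{n_u}$ are given, generated by $x_{k+1}=A_*x_k+B_*u_k+w_k$ with unknown matrices $A_*\in\mathbb{R}^{n_x\times n_x}$, $B_*\in\mathbb{R}^{n_x\times n_u}$ and unknown noise satisfying $\|w_k\|_2\le\epsilon$ for $k=0,\ldots,T-1$, where $\epsilon>0$ is known. For $i=0,\ldots,T-1$ define the symmetric matrix of size $2n_x+n_u$ $$\Psi_i=\begin{bmatrix} I & x_{i+1}\\ 0&-x_i\\ 0&-u_i\end{bmatrix}\begin{bmatrix}\epsilon^2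 I&0\\ 0&-1\end{bmatrix}\begin{bmatrix} I & x_{i+1}\\ 0&-x_i\\ 0&-u_i\end{bmatrix}^\top .$$ The set of system matrices consistent with the data is $$\Sigma=\bigcap_{i=0}^{T-1}\left\{(A,B)\in\mathbb{R}^{n_x\times n_x}\times\mathbb{R}^{n_x\times n_u}\ :\ \begin{bmatrix} I\\ A^\top\\ B^\top\end{bmatrix}^\top\Psi_i\begin{bmatrix} I\\ A^\top\\ B^\top\end{bmatrix}\succeq0\right\}.$$ *)

theory Defs
  imports "HOL-Analysis.Analysis"
begin

text \<open>
  The rows and columns of a block matrix are indexed by sum types, so that for instance an
  index of type \<open>'n + ('n + 'm)\<close> stands for a size of \<open>2 n\<^sub>x + n\<^sub>u\<close> with \<open>n\<^sub>x = CARD('n)\<close>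
  and \<open>n\<^sub>u = CARD('m)\<close>.  Below, \<open>hcat A B\<close> is the block row \<open>[A B]\<close> and \<open>vcat A B\<close> is
  the block column with \<open>A\<close> on top of \<open>B\<close>.
\<close>

definition hcat :: "'a^'p^'r \<Rightarrow> 'a^'q^'r \<Rightarrow> 'a^('p + 'q)^'r" where
  "hcat A B = (\<chi> i j. case j of Inl k \<Rightarrow> A $ i $ k | Inr k \<Rightarrow> B $ i $ k)"

definition vcat :: "'a^'q^'r \<Rightarrow> 'a^'q^'s \<Rightarrow> 'a^'q^('r + 's)" where
  "vcat A B = (\<chi> i. case i of Inl k \<Rightarrow> A $ k | Inr k \<Rightarrow> B $ k)"

definition block_mat ::
  "'a^'p^'r \<Rightarrow> 'a^'q^'r \<Rightarrow> 'a^'p^'s \<Rightarrow> 'a^'q^'s \<Rightarrow> 'a^('p + 'q)^('r + 's)" where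
  "block_mat A B C D = vcat (hcat A B) (hcat C D)"

definition pos_semidef :: "real^'n^'n \<Rightarrow> bool" where
  "pos_semidef M \<longleftrightarrow> transpose M = M \<and> (\<forall>v. 0 \<le> v \<bullet> (M *v v))"

definition pos_def :: "real^'n^'n \<Rightarrow> bool" where
  "pos_def M \<longleftrightarrow> transpose M = M \<and> (\<forall>v. v \<noteq> 0 \<longrightarrow> 0 < v \<bullet> (M *v v))"

definition data_factor ::
  "(nat \<Rightarrow> real^'n) \<Rightarrow> (nat \<Rightarrow> real^'m) \<Rightarrow> nat \<Rightarrow> real^('n + 1)^('n + ('n + 'm))" where
  "data_factor x u i =
     vcat (hcat (mat 1) (columnvector (x (Suc i))))
    (vcat (hcat 0 (columnvector (- x i)))
          (hcat 0 (columnvector (- u i))))"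

definition data_Psi ::
  "real \<Rightarrow> (nat \<Rightarrow> real^'n) \<Rightarrow> (nat \<Rightarrow> real^'m) \<Rightarrow> nat
    \<Rightarrow> real^('n + ('n + 'm))^('n + ('n + 'm))" where
  "data_Psi \<epsilon> x u i =
     data_factor x u i ** block_mat (\<epsilon>\<^sup>2 *\<^sub>R mat 1) 0 0 (- mat 1)
       ** transpose (data_factor x u i)"

definition consistent_systems ::
  "nat \<Rightarrow> real \<Rightarrow> (nat \<Rightarrow> real^'n) \<Rightarrow> (nat \<Rightarrow> real^'m) \<Rightarrow> ((real^'n^'n) \<times> (real^'m^'n)) set" where
  "consistent_systems T \<epsilon> x u =
     (\<Inter>i<T. {(A, B). pos_semidef
        (transpose (vcat (mat 1) (vcat (transpose A) (transpose B)))
          ** data_Psi \<epsilon> x u i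
          ** vcat (mat 1) (vcat (transpose A) (transpose B)))})"

end

theory Submission
  imports Defs
begin

text \<open>
  Write \<open>F = A + B K\<close>.  Every vector of the form
  \<open>q = (v, A\<^sup>T v, B\<^sup>T v)\<close> has \<open>q\<^sup>T \<Psi>\<^sub>i q \<ge> 0\<close> for each data point, since \<open>(A, B)\<close> is consistent
  with the data.  Evaluating the assumed matrix inequality at \<open>q\<close> and dropping these nonnegative
  terms (the easy direction of the S-procedure) leaves
  \<open>\<beta> |v|\<^sup>2 \<le> v\<^sup>T (P - F P F\<^sup>T - G G\<^sup>T) v\<close>: the closed loop satisfies a strict Lyapunov inequality.
  The bracket is the Schur complement of the block \<open>diag(P, I)\<close> in the matrix of the conclusion,
  so completing squares turns the latter's quadratic form into
  \<open>a\<^sup>T (P - F P F\<^sup>T - G G\<^sup>T) a + (b + F\<^sup>T a)\<^sup>T P (b + F\<^sup>T a) + |c + G\<^sup>T a|\<^sup>2\<close>,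
  which is positive unless \<open>a\<close>, \<open>b\<close> and \<open>c\<close> all vanish.  The two halves of the argument are
  \<open>consistent_lyapunov\<close> and \<open>pos_def_schur\<close>.
\<close>

definition vjoin :: "'a^'r \<Rightarrow> 'a^'s \<Rightarrow> 'a^('r + 's)" where
  "vjoin a b = (\<chi> i. case i of Inl k \<Rightarrow> a $ k | Inr k \<Rightarrow> b $ k)"

lemma vjoin_split: obtains a b where "v = vjoin a b"
proof
  show "v = vjoin (\<chi> k. v $ Inl k) (\<chi> k. v $ Inr k)"
    by (simp add: vjoin_def vec_eq_iff split: sum.split)
qed

lemma vjoin_zero [simp]: "vjoin 0 0 = 0"
  by (simp add: vjoin_def vec_eq_iff split: sum.split)

lemma inner_vjoin [simp]:
  fixes a c :: "real^'r" and b d :: "real^'s"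
  shows "vjoin a b \<bullet> vjoin c d = a \<bullet> c + b \<bullet> d"
  by (simp add: inner_vec_def vjoin_def UNIV_Plus_UNIV [symmetric] sum.Plus del: UNIV_Plus_UNIV)

lemma vcat_mult_vec [simp]: "vcat A B *v v = vjoin (A *v v) (B *v v)"
  by (simp add: vcat_def vjoin_def vec_eq_iff matrix_vector_mult_def split: sum.split)

lemma hcat_mult_vjoin [simp]: "hcat A B *v vjoin a b = A *v a + B *v b"
  by (simp add: hcat_def vjoin_def vec_eq_iff matrix_vector_mult_def
      UNIV_Plus_UNIV [symmetric] sum.Plus del: UNIV_Plus_UNIV)

lemma transpose_vcat [simp]: "transpose (vcat A B) = hcat (transpose A) (transpose B)"
  by (simp add: transpose_def vcat_def hcat_def vec_eq_iff split: sum.split)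

lemma transpose_hcat [simp]: "transpose (hcat A B) = vcat (transpose A) (transpose B)"
  by (simp add: transpose_def vcat_def hcat_def vec_eq_iff split: sum.split)

text \<open>Brings a transposed block matrix, which is a row of columns, back to a column of rows.\<close>

lemma hcat_vcat: "hcat (vcat A C) (vcat B D) = vcat (hcat A B) (hcat C D)"
  by (simp add: vcat_def hcat_def vec_eq_iff split: sum.split)

lemma transpose_zero [simp]: "transpose 0 = 0"
  by (simp add: transpose_def vec_eq_iff)

lemma transpose_add: "transpose (A + B) = transpose A + transpose B"
  by (simp add: transpose_def vec_eq_iff)

lemma minus_matrix_vector_mult: "(- M) *v v = - (M *v v)" for M :: "real^'n^'m"
  by (simp add: matrix_vector_mult_def vec_eq_iff sum_negf)

lemma inner_matrix_transpose:
  fixes M :: "real^'n^'m"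
  shows "x \<bullet> (M *v y) = (transpose M *v x) \<bullet> y"
  by (simp add: dot_lmul_matrix)

lemma inner_congruence:
  fixes Z :: "real^'k^'n" and M :: "real^'k^'k"
  shows "v \<bullet> ((Z ** M ** transpose Z) *v v) = (transpose Z *v v) \<bullet> (M *v (transpose Z *v v))"
  by (metis inner_matrix_transpose matrix_vector_mul_assoc)

lemma inner_weighted_sum_matrix:
  fixes M :: "nat \<Rightarrow> real^'n^'n"
  shows "q \<bullet> ((\<Sum>i<T. c i *\<^sub>R M i) *v q) = (\<Sum>i<T. c i * (q \<bullet> (M i *v q)))"
  by (induction T) (simp_all add: matrix_vector_mult_add_rdistrib inner_add_right
      scaleR_matrix_vector_assoc [symmetric])

text \<open>
  Consistency with a data point says exactly that \<open>\<Psi>\<^sub>i\<close> is nonnegative on the range of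
  \<open>[I; A\<^sup>T; B\<^sup>T]\<close>, which makes the multiplier terms disappear in the right direction.
\<close>

lemma consistent_lyapunov:
  fixes P :: "real^'n^'n" and K :: "real^'n^'m" and G :: "real^'d^'n"
  assumes AB: "(A, B) \<in> consistent_systems T \<epsilon> x u"
    and \<alpha>: "\<And>i. i < T \<Longrightarrow> 0 \<le> \<alpha> i"
    and psd: "pos_semidef
        (block_mat
           (P - G ** transpose G - \<beta> *\<^sub>R mat 1)  0
           0  (- (vcat (mat 1) K ** P ** transpose (vcat (mat 1) K)))
         - (\<Sum>i<T. \<alpha> i *\<^sub>R data_Psi \<epsilon> x u i))"
  defines "F \<equiv> A + B ** K"
  shows "\<beta> * (v \<bullet> v) \<le> v \<bullet> (P *v v) - (transpose F *v v) \<bullet> (P *v (transpose F *v v))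
           - (transpose G *v v) \<bullet> (transpose G *v v)"
proof -
  define Z where "Z = vcat (mat 1) (vcat (transpose A) (transpose B))"
  define q where "q = Z *v v"
  define r where "r = vjoin (transpose A *v v) (transpose B *v v)"
  have q: "q = vjoin v r"
    by (simp add: q_def Z_def r_def)
  have "0 \<le> q \<bullet> (data_Psi \<epsilon> x u i *v q)" if "i < T" for i
  proof -
    have "pos_semidef (transpose Z ** data_Psi \<epsilon> x u i ** Z)"
      using AB that by (auto simp: consistent_systems_def Z_def)
    then have "0 \<le> v \<bullet> ((transpose Z ** data_Psi \<epsilon> x u i ** Z) *v v)"
      by (simp add: pos_semidef_def)
    then show ?thesis
      using inner_congruence [of v "transpose Z" "data_Psi \<epsilon> x u i"] by (simp add: q_def)
  qed
  then have multipliers: "0 \<le> (\<Sum>i<T. \<alpha> i * (q \<bullet> (data_Psi \<epsilon> x u i *v q)))"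
    by (intro sum_nonneg mult_nonneg_nonneg) (auto intro: \<alpha>)
  let ?N = "vcat (mat 1) K ** P ** transpose (vcat (mat 1) K)"
  have "transpose (vcat (mat 1) K) *v r = transpose F *v v"
    by (simp add: r_def F_def transpose_matrix_vector [symmetric] matrix_transpose_mul
        transpose_add matrix_vector_mult_add_rdistrib matrix_vector_mul_assoc
        del: transpose_matrix_vector)
  then have N: "r \<bullet> (?N *v r) = (transpose F *v v) \<bullet> (P *v (transpose F *v v))"
    by (simp only: inner_congruence)
  have G: "v \<bullet> ((G ** transpose G) *v v) = (transpose G *v v) \<bullet> (transpose G *v v)"
    by (metis inner_matrix_transpose matrix_vector_mul_assoc)
  have "0 \<le> q \<bullet> ((block_mat (P - G ** transpose G - \<beta> *\<^sub>R mat 1) 0 0 (- ?N)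
         - (\<Sum>i<T. \<alpha> i *\<^sub>R data_Psi \<epsilon> x u i)) *v q)"
    using psd unfolding pos_semidef_def by blast
  also have "\<dots> = q \<bullet> (block_mat (P - G ** transpose G - \<beta> *\<^sub>R mat 1) 0 0 (- ?N) *v q)
      - (\<Sum>i<T. \<alpha> i * (q \<bullet> (data_Psi \<epsilon> x u i *v q)))"
    by (simp only: matrix_vector_mult_diff_rdistrib inner_diff_right inner_weighted_sum_matrix)
  also have "q \<bullet> (block_mat (P - G ** transpose G - \<beta> *\<^sub>R mat 1) 0 0 (- ?N) *v q)
      = v \<bullet> (P *v v) - v \<bullet> ((G ** transpose G) *v v) - \<beta> * (v \<bullet> v) - r \<bullet> (?N *v r)"
    unfolding q block_mat_def
    by (simp add: matrix_vector_mult_diff_rdistrib inner_diff_right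
        scaleR_matrix_vector_assoc [symmetric] minus_matrix_vector_mult
        del: transpose_vcat transpose_matrix_vector)
  finally show ?thesis
    using multipliers N G by linarith
qed

text \<open>
  One direction of the Schur complement criterion, with the block \<open>diag(P, I)\<close> eliminated.  Taking
  the complement as a bound on quadratic forms spares inverting \<open>P\<close>: completing the square in \<open>b\<close>
  only needs the off-diagonal block to have the factor \<open>P\<close>.
\<close>

lemma pos_def_schur:
  fixes P F :: "real^'n^'n" and G :: "real^'d^'n"
  assumes P: "pos_def P"
    and schur: "\<And>v. v \<noteq> 0 \<Longrightarrow> 0 < v \<bullet> (P *v v)
      - (transpose F *v v) \<bullet> (P *v (transpose F *v v)) - (transpose G *v v) \<bullet> (transpose G *v v)"
  shows "pos_def
      (vcat (hcat P                  (hcat (F ** P)  G))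
      (vcat (hcat (P ** transpose F) (hcat P         0))
            (hcat (transpose G)      (hcat 0         (mat 1)))))"
    (is "pos_def ?M")
  unfolding pos_def_def
proof (intro conjI allI impI)
  have sym: "transpose P = P" and pos: "\<And>v. v \<noteq> 0 \<Longrightarrow> 0 < v \<bullet> (P *v v)"
    using P by (auto simp: pos_def_def)
  then have nonneg: "0 \<le> v \<bullet> (P *v v)" for v
    by (cases "v = 0") (auto intro: less_imp_le)
  show "transpose ?M = ?M"
    by (simp add: hcat_vcat matrix_transpose_mul sym)
  fix z :: "real^('n + ('n + 'd))" assume "z \<noteq> 0"
  obtain a y where "z = vjoin a y" by (rule vjoin_split)
  moreover obtain b c where "y = vjoin b c" by (rule vjoin_split)
  ultimately have z: "z = vjoin a (vjoin b c)" by simp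
  define f where "f = transpose F *v a"
  define g where "g = transpose G *v a"
  have "b \<bullet> (P *v f) = f \<bullet> (P *v b)"
    by (metis inner_commute inner_matrix_transpose sym)
  moreover have "z \<bullet> (?M *v z) = a \<bullet> (P *v a) + f \<bullet> (P *v b) + g \<bullet> c
      + (b \<bullet> (P *v f) + b \<bullet> (P *v b)) + (c \<bullet> g + c \<bullet> c)"
    by (simp add: z f_def g_def inner_add_right inner_matrix_transpose [of a]
        matrix_vector_mul_assoc [symmetric] del: transpose_matrix_vector)
  ultimately have form: "z \<bullet> (?M *v z) = (a \<bullet> (P *v a) - f \<bullet> (P *v f) - g \<bullet> g)
      + (b + f) \<bullet> (P *v (b + f)) + (c + g) \<bullet> (c + g)"
    by (simp add: matrix_vector_right_distrib inner_add_left inner_add_right inner_commute)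
  show "0 < z \<bullet> (?M *v z)"
  proof (cases "a = 0")
    case True
    then have "f = 0" "g = 0" by (simp_all add: f_def g_def)
    with True have "z \<bullet> (?M *v z) = b \<bullet> (P *v b) + c \<bullet> c" using form by simp
    moreover have "b \<noteq> 0 \<or> c \<noteq> 0" using \<open>z \<noteq> 0\<close> z True by auto
    ultimately show ?thesis
      using pos [of b] nonneg [of b]
      by (cases "b = 0") (auto intro: add_pos_nonneg)
  next
    case False
    then show ?thesis
      using form schur [of a] nonneg [of "b + f"] inner_ge_zero [of "c + g"]
      unfolding f_def g_def by linarith
  qed
qed

theorem proposition1:
  fixes T :: nat
    and \<epsilon> :: real
    and x w :: "nat \<Rightarrow> real^'n"
    and u :: "nat \<Rightarrow> real^'m"
    and A\<^sub>0 :: "real^'n^'n"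
    and B\<^sub>0 :: "real^'m^'n"
    and P :: "real^'n^'n"
    and K :: "real^'n^'m"
    and G :: "real^'d^'n"
  assumes "0 < T"
    and "0 < \<epsilon>"
    and "\<And>k. k < T \<Longrightarrow> x (Suc k) = A\<^sub>0 *v x k + B\<^sub>0 *v u k + w k"
    and "\<And>k. k < T \<Longrightarrow> norm (w k) \<le> \<epsilon>"
    and "pos_def P"
    and "\<exists>(\<alpha> :: nat \<Rightarrow> real) (\<beta> :: real). (\<forall>i<T. 0 \<le> \<alpha> i) \<and> 0 < \<beta> \<and>
      pos_semidef
        (block_mat
           (P - G ** transpose G - \<beta> *\<^sub>R mat 1)  0
           0  (- (vcat (mat 1) K ** P ** transpose (vcat (mat 1) K)))
         - (\<Sum>i<T. \<alpha> i *\<^sub>R data_Psi \<epsilon> x u i))"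
  shows "\<forall>(A, B) \<in> consistent_systems T \<epsilon> x u.
    pos_def
      (vcat (hcat P                                 (hcat ((A + B ** K) ** P)  G))
      (vcat (hcat (P ** transpose (A + B ** K))     (hcat P                    0))
            (hcat (transpose G)                     (hcat 0                    (mat 1)))))"
proof (intro ballI, clarify)
  fix A :: "real^'n^'n" and B :: "real^'m^'n"
  assume AB: "(A, B) \<in> consistent_systems T \<epsilon> x u"
  from assms(6) obtain \<alpha> \<beta> where \<alpha>: "\<And>i. i < T \<Longrightarrow> 0 \<le> \<alpha> i" and "0 < \<beta>"
    and psd: "pos_semidef
        (block_mat
           (P - G ** transpose G - \<beta> *\<^sub>R mat 1)  0
           0  (- (vcat (mat 1) K ** P ** transpose (vcat (mat 1) K)))
         - (\<Sum>i<T. \<alpha> i *\<^sub>R data_Psi \<epsilon> x u i))"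
    by blast
  show "pos_def
      (vcat (hcat P                                 (hcat ((A + B ** K) ** P)  G))
      (vcat (hcat (P ** transpose (A + B ** K))     (hcat P                    0))
            (hcat (transpose G)                     (hcat 0                    (mat 1)))))"
  proof (rule pos_def_schur [OF assms(5)])
    fix v :: "real^'n" assume "v \<noteq> 0"
    then have "0 < \<beta> * (v \<bullet> v)" using \<open>0 < \<beta>\<close> by simp
    also note consistent_lyapunov [OF AB \<alpha> psd]
    finally show "0 < v \<bullet> (P *v v)
      - (transpose (A + B ** K) *v v) \<bullet> (P *v (transpose (A + B ** K) *v v))
      - (transpose G *v v) \<bullet> (transpose G *v v)" .
  qed
qed

end
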